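(* Let $(\mathcal{A},\varphi)$ be a non-commutative probability space and let $(\mathcal{A}_i)_{i\in I}$ be a family of subalgebras of $\mathcal{A}$ that is BMT independent with respect to a digraph $G=(I,E)$. Then: (i) the algebras $(\mathcal{A}_i)_{i\in I}$ are tensor independent if $G$ is the complete graph (i.e. $E$ contains all $(i,j)\in I\times I$ with $i\neq j$); (ii) the algebras $(\mathcal{A}_i)_{i\in I}$ are boolean independent if $G$ is the empty graph (i.e. $E=\emptyset$); (iii) the algebras $(\mathcal{A}_i)_{i\in I}$ are monotone independent if $I$ has a total order $<$ and $G$ is the digraph of $<$, i.e. $(i,j)$ is an edge of $G$ if and only if $j<i$.
   Context: A non-commutative probability space is a pair $(\mathcal{A},\varphi)$ with $\mathcal{A}$ a complex unital algebra and $\varphi:\mathcal{A}\to\mathbb{C}$ linear with $\varphi(1)=1$. Subalgebras need not be unital. $[m]=\{1,\dots,m\}$. A digraph $G=(I,E)$ has $E\subset I\times I$ with no loops. For $\mathbf{i}=(i_1,\dots,i_m)$ with $i_k\in I$, $\ker[\mathbf{i}]$ is the partition of $[m]$ given by $k\sim k'$ iff $i_k=i_{k'}$, and $\ker_G[\mathbf{i}]$ is the partition given by: $k\sim k'$ iff $i_k=i_{k'}$ and $(i_\ell,i_k)\in E$ for every $\ell$ strictly between $k$ and $k'$ with $i_\ell\neq i_k$. For $B=\{k_1<\cdots<k_r\}$ put $(a_k)|_B=a_{k_1}\cdots a_{k_r}$. The family is BMT independent with respect to $G$ (more precisely $(\varphi,G)$) if $\varphi(a_1\cdots a_m)=\prod_{B\in\ker_G[\mathbf{i}]}\varphi((a_k)|_B)$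 for all $m\ge1$ and $a_k\in\mathcal{A}_{i_k}$. A product $a_1\cdots a_m$ with $a_k\in\mathcal{A}_{i_k}$ is alternating if $i_1\ne i_2,\dots,i_{m-1}\neq i_m$. The family is: - boolean independent if $\varphi(a_1\cdots a_m)=\varphi(a_1)\cdots\varphi(a_m)$ for every alternating product; - monotone independent (for a linear order $<$ on $I$) if for every alternating product: (M.1) $\varphi(a_1\cdots a_m)=\varphi(a_k)\varphi(a_1\cdots a_{k-1}a_{k+1}\cdots a_m)$ whenever $i_{k-1}<i_k>i_{k+1}$ for some $k\in\{2,\dots,m-1\}$; and (M.2) $\varphi(a_1\cdots a_m)=\prod_{\ell=1}^m\varphi(a_\ell)$ whenever $i_1>\cdots>i_{k-1}>i_k<i_{k+1}<\cdots<i_m$ for some $k\in[m]$; - tensor independent if for every (not necessarily alternating) product with $a_k\in\mathcal{A}_{i_k}$, $\varphi(a_1\cdots a_m)=\prod_{B\in\ker[\mathbf{i}]}\varphi((a_k)|_B)$. *)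

theory Defs
  imports Complex_Main
begin

text \<open>HOL has no class of complex algebras, so the complex scalar multiplication on the ring is
  an explicit parameter, as in the library locale \<^locale>\<open>vector_space\<close>. The axiom
  \<open>0 \<noteq> 1\<close> of the class \<^class>\<open>ring_1\<close> is no restriction for a non-commutative probability
  space, where \<open>\<phi> 0 = 0\<close> and \<open>\<phi> 1 = 1\<close>.\<close>

locale complex_unital_algebra = vector_space scale
  for scale :: "complex \<Rightarrow> 'a::ring_1 \<Rightarrow> 'a" +
  assumes mult_scale_left: "scale c x * y = scale c (x * y)"
    and mult_scale_right: "x * scale c y = scale c (x * y)"

locale nc_probability_space =
  complex_unital_algebra scale + Vector_Spaces.linear scale "(*)" \<phi>
  for scale :: "complex \<Rightarrow> 'a::ring_1 \<Rightarrow> 'a" and \<phi> :: "'a \<Rightarrow> complex" +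
  assumes state_one: "\<phi> 1 = 1"

text \<open>Subalgebras need not contain the unit.\<close>

definition subalgebra :: "(complex \<Rightarrow> 'a::ring_1 \<Rightarrow> 'a) \<Rightarrow> 'a set \<Rightarrow> bool" where
  "subalgebra scale S \<longleftrightarrow>
     module.subspace scale S \<and> (\<forall>x\<in>S. \<forall>y\<in>S. x * y \<in> S)"

definition digraph :: "'i set \<Rightarrow> ('i \<times> 'i) set \<Rightarrow> bool" where
  "digraph I E \<longleftrightarrow> E \<subseteq> I \<times> I \<and> irrefl E"

text \<open>A tuple of length \<open>m\<close> is a function on \<^typ>\<open>nat\<close> of which only the values on \<open>{1..m}\<close>
  matter. For a finite set \<open>B\<close> of positions, \<open>restr_prod a B\<close> multiplies the \<open>a k\<close>, \<open>k \<in> B\<close>, in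
  increasing order of \<open>k\<close>.\<close>

definition restr_prod :: "(nat \<Rightarrow> 'a::ring_1) \<Rightarrow> nat set \<Rightarrow> 'a" where
  "restr_prod a B = prod_list (map a (sorted_list_of_set B))"

definition ker_rel :: "(nat \<Rightarrow> 'i) \<Rightarrow> nat \<Rightarrow> nat rel" where
  "ker_rel i m = {(k, k'). k \<in> {1..m} \<and> k' \<in> {1..m} \<and> i k = i k'}"

definition kerG_rel :: "('i \<times> 'i) set \<Rightarrow> (nat \<Rightarrow> 'i) \<Rightarrow> nat \<Rightarrow> nat rel" where
  "kerG_rel E i m = {(k, k'). k \<in> {1..m} \<and> k' \<in> {1..m} \<and> i k = i k' \<and>
     (\<forall>l. min k k' < l \<and> l < max k k' \<and> i l \<noteq> i k \<longrightarrow> (i l, i k) \<in> E)}"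

lemma equiv_ker_rel: "equiv {1..m} (ker_rel i m)"
  by (rule equivI) (auto simp: ker_rel_def refl_on_def sym_def trans_def)

lemma equiv_kerG_rel: "equiv {1..m} (kerG_rel E i m)"
proof (rule equivI)
  show "trans (kerG_rel E i m)"
  proof (rule transI)
    fix x y z
    assume xy: "(x, y) \<in> kerG_rel E i m" and yz: "(y, z) \<in> kerG_rel E i m"
    have "(i l, i x) \<in> E" if "min x z < l" "l < max x z" "i l \<noteq> i x" for l
    proof -
      have "l \<noteq> y" using xy that by (auto simp: kerG_rel_def)
      then have "(min x y < l \<and> l < max x y) \<or> (min y z < l \<and> l < max y z)"
        using that by linarith
      then show ?thesis using xy yz that by (auto simp: kerG_rel_def)
    qed
    then show "(x, z) \<in> kerG_rel E i m" using xy yz by (auto simp: kerG_rel_def)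
  qed
qed (auto simp: kerG_rel_def refl_on_def sym_def min.commute max.commute)

definition ker :: "(nat \<Rightarrow> 'i) \<Rightarrow> nat \<Rightarrow> nat set set" where
  "ker i m = {1..m} // ker_rel i m"

definition kerG :: "('i \<times> 'i) set \<Rightarrow> (nat \<Rightarrow> 'i) \<Rightarrow> nat \<Rightarrow> nat set set" where
  "kerG E i m = {1..m} // kerG_rel E i m"

definition is_word ::
    "'i set \<Rightarrow> ('i \<Rightarrow> 'a set) \<Rightarrow> nat \<Rightarrow> (nat \<Rightarrow> 'i) \<Rightarrow> (nat \<Rightarrow> 'a) \<Rightarrow> bool" where
  "is_word I \<A> m i a \<longleftrightarrow> 1 \<le> m \<and> (\<forall>k\<in>{1..m}. i k \<in> I \<and> a k \<in> \<A> (i k))"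

definition alternating :: "nat \<Rightarrow> (nat \<Rightarrow> 'i) \<Rightarrow> bool" where
  "alternating m i \<longleftrightarrow> (\<forall>k\<in>{1..<m}. i k \<noteq> i (k + 1))"

definition BMT_independent ::
    "('a::ring_1 \<Rightarrow> complex) \<Rightarrow> 'i set \<Rightarrow> ('i \<times> 'i) set \<Rightarrow> ('i \<Rightarrow> 'a set) \<Rightarrow> bool" where
  "BMT_independent \<phi> I E \<A> \<longleftrightarrow>
     (\<forall>m i a. is_word I \<A> m i a \<longrightarrow>
        \<phi> (restr_prod a {1..m}) = (\<Prod>B\<in>kerG E i m. \<phi> (restr_prod a B)))"

definition tensor_independent ::
    "('a::ring_1 \<Rightarrow> complex) \<Rightarrow> 'i set \<Rightarrow> ('i \<Rightarrow> 'a set) \<Rightarrow> bool" where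
  "tensor_independent \<phi> I \<A> \<longleftrightarrow>
     (\<forall>m i a. is_word I \<A> m i a \<longrightarrow>
        \<phi> (restr_prod a {1..m}) = (\<Prod>B\<in>ker i m. \<phi> (restr_prod a B)))"

definition boolean_independent ::
    "('a::ring_1 \<Rightarrow> complex) \<Rightarrow> 'i set \<Rightarrow> ('i \<Rightarrow> 'a set) \<Rightarrow> bool" where
  "boolean_independent \<phi> I \<A> \<longleftrightarrow>
     (\<forall>m i a. is_word I \<A> m i a \<and> alternating m i \<longrightarrow>
        \<phi> (restr_prod a {1..m}) = (\<Prod>k=1..m. \<phi> (a k)))"

text \<open>The strict linear order on \<open>I\<close> is a relation \<open>r\<close>, with \<open>(i, j) \<in> r\<close> meaning \<open>i < j\<close>.\<close>

definition monotone_independent ::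
    "('a::ring_1 \<Rightarrow> complex) \<Rightarrow> 'i set \<Rightarrow> 'i rel \<Rightarrow> ('i \<Rightarrow> 'a set) \<Rightarrow> bool" where
  "monotone_independent \<phi> I r \<A> \<longleftrightarrow>
     (\<forall>m i a. is_word I \<A> m i a \<and> alternating m i \<longrightarrow>
        (\<forall>k\<in>{2..m - 1}. (i (k - 1), i k) \<in> r \<and> (i (k + 1), i k) \<in> r \<longrightarrow>
           \<phi> (restr_prod a {1..m}) = \<phi> (a k) * \<phi> (restr_prod a ({1..m} - {k}))) \<and>
        ((\<exists>k\<in>{1..m}. (\<forall>l\<in>{1..<k}. (i (l + 1), i l) \<in> r) \<and>
                       (\<forall>l\<in>{k..<m}. (i l, i (l + 1)) \<in> r)) \<longrightarrow>
           \<phi> (restr_prod a {1..m}) = (\<Prod>l=1..m. \<phi> (a l))))"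

end

theory Submission
  imports Defs
begin

text \<open>Each claim is a computation of \<open>kerG\<close>. For the complete graph it is \<open>ker\<close>. For the empty
  graph, and for a monotone valley word, two distinct positions of the same colour are separated by
  a neighbour of one of them that violates the edge condition, so every block is a singleton. At a
  peak \<open>k\<close>, a neighbour of \<open>k\<close> violates the edge condition for every block through \<open>k\<close>, so \<open>{k}\<close> is
  a block; and deleting \<open>k\<close> does not change the other blocks, because a block that may pass over
  the smaller letter at \<open>k - 1\<close> may also pass over the letter at \<open>k\<close>.\<close>

section \<open>Ordered products and extreme cases of the kernel partition\<close>

lemma restr_prod_singleton [simp]: "restr_prod a {k} = a k"
  by (simp add: restr_prod_def)

text \<open>A strictly increasing map carries the increasing enumeration of \<open>B\<close> to that
  of its image, so a relabelling of positions can be absorbed into the tuple.\<close>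

lemma restr_prod_image:
  assumes "finite B" "strict_mono f"
  shows "restr_prod a (f ` B) = restr_prod (a \<circ> f) B"
proof -
  have "sorted_list_of_set (f ` B) = map f (sorted_list_of_set B)"
    using assms
    by (subst sorted_list_of_set_unique[symmetric])
      (auto simp: sorted_wrt_map strict_mono_less card_image strict_mono_imp_inj_on)
  then show ?thesis by (simp add: restr_prod_def)
qed

lemma quotient_Id_on: "A // Id_on A = (\<lambda>x. {x}) ` A"
  by (auto simp: quotient_def Id_on_def)

text \<open>Positions strictly between two members of \<open>{1..m}\<close> lie in
  \<open>{1..m}\<close> too, so edges among the colours that occur there already make the edge
  condition hold automatically.\<close>

lemma kerG_eq_ker:
  assumes "\<And>k l. k \<in> {1..m} \<Longrightarrow> l \<in> {1..m} \<Longrightarrow> i k \<noteq> i l \<Longrightarrow> (i k, i l) \<in> E"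
  shows "kerG E i m = ker i m"
proof -
  have "kerG_rel E i m = ker_rel i m"
    using assms by (fastforce simp: kerG_rel_def ker_rel_def)
  then show ?thesis by (simp add: kerG_def ker_def)
qed

lemma kerG_rel_sym: "(x, y) \<in> kerG_rel E i m \<Longrightarrow> (y, x) \<in> kerG_rel E i m"
  using equiv_kerG_rel by (metis equivE symE)

lemma kerG_rel_edge:
  assumes "(x, y) \<in> kerG_rel E i m" "x < l" "l < y" "i l \<noteq> i x"
  shows "(i l, i x) \<in> E"
  using assms by (auto simp: kerG_rel_def)

text \<open>Excluding related pairs \<open>x < y\<close> is enough: by symmetry the relation is then
  the identity on \<open>{1..m}\<close>, and the product over blocks becomes a product over
  positions.\<close>

lemma prod_kerG_singletons:
  assumes "\<And>x y. (x, y) \<in> kerG_rel E i m \<Longrightarrow> \<not> x < y"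
  shows "(\<Prod>B\<in>kerG E i m. \<phi> (restr_prod a B)) = (\<Prod>k=1..m. \<phi> (a k))"
proof -
  have "x = y" if "(x, y) \<in> kerG_rel E i m" for x y
    using assms[OF that] assms[OF kerG_rel_sym[OF that]] by simp
  moreover have "(x, x) \<in> kerG_rel E i m" if "x \<in> {1..m}" for x
    using that by (auto simp: kerG_rel_def)
  moreover have "x \<in> {1..m}" if "(x, y) \<in> kerG_rel E i m" for x y
    using that by (simp add: kerG_rel_def)
  ultimately have "(x, y) \<in> kerG_rel E i m \<longleftrightarrow> (x, y) \<in> Id_on {1..m}" for x y
    unfolding Id_on_iff by blast
  then have "kerG_rel E i m = Id_on {1..m}" by auto
  then have "kerG E i m = (\<lambda>x. {x}) ` {1..m}"
    by (simp add: kerG_def quotient_Id_on)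
  then show ?thesis by (simp add: prod.reindex)
qed

section \<open>Deleting one position from a word\<close>

text \<open>The increasing enumeration of the naturals other than \<open>k\<close> (a simplicial
  coface map); composing a tuple with it removes entry \<open>k\<close>.\<close>

definition skip :: "nat \<Rightarrow> nat \<Rightarrow> nat" where
  "skip k j = (if j < k then j else Suc j)"

lemma strict_mono_skip: "strict_mono (skip k)"
  by (auto simp: strict_mono_def skip_def)

lemma skip_less_iff: "skip k x < skip k y \<longleftrightarrow> x < y"
  by (rule strict_mono_less[OF strict_mono_skip])

lemma inj_skip: "inj (skip k)"
  by (rule strict_mono_imp_inj_on[OF strict_mono_skip])

lemma skip_image:
  assumes "k \<in> {1..m}"
  shows "skip k ` {1..m - 1} = {1..m} - {k}"
proof
  show "{1..m} - {k} \<subseteq> skip k ` {1..m - 1}"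
  proof
    fix x assume x: "x \<in> {1..m} - {k}"
    have "x = skip k (if x < k then x else x - 1)" using x by (auto simp: skip_def)
    moreover have "(if x < k then x else x - 1) \<in> {1..m - 1}" using x assms by auto
    ultimately show "x \<in> skip k ` {1..m - 1}" by blast
  qed
qed (use assms in \<open>auto simp: skip_def split: if_splits\<close>)

lemma min_max_skip:
  "min (skip k x) (skip k y) = skip k (min x y)" "max (skip k x) (skip k y) = skip k (max x y)"
  by (auto simp: min_def max_def skip_def)

text \<open>The two edge conditions differ only at position \<open>k\<close>, which the longer word
  tests in addition. Assumption \<open>pass\<close> derives this extra test from the letter at
  \<open>k - 1\<close>, which has the block's colour or has passed the test itself.\<close>

lemma kerG_rel_skip:
  assumes k: "k \<in> {2..m - 1}"
    and x: "x \<in> {1..m - 1}" and y: "y \<in> {1..m - 1}"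
    and pass: "\<And>p. p \<in> {1..m} \<Longrightarrow> i p = i (k - 1) \<or> (i (k - 1), i p) \<in> E \<Longrightarrow> (i k, i p) \<in> E"
  shows "(x, y) \<in> kerG_rel E (i \<circ> skip k) (m - 1) \<longleftrightarrow> (skip k x, skip k y) \<in> kerG_rel E i m"
    (is "?L \<longleftrightarrow> ?R")
proof
  have im: "skip k ` {1..m - 1} = {1..m} - {k}"
    using k by (intro skip_image) auto
  have mem: "skip k z \<in> {1..m}" if "z \<in> {1..m - 1}" for z
    using im that by blast
  show ?R if L: ?L
  proof -
    have eq: "i (skip k x) = i (skip k y)" using L by (simp add: kerG_rel_def)
    have edge: "\<forall>l. min x y < l \<and> l < max x y \<and> i (skip k l) \<noteq> i (skip k x) \<longrightarrow>
        (i (skip k l), i (skip k x)) \<in> E"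
      using L unfolding kerG_rel_def mem_Collect_eq prod.case comp_apply by (elim conjE) assumption
    have "(i l, i (skip k x)) \<in> E"
      if l: "skip k (min x y) < l" "l < skip k (max x y)" "i l \<noteq> i (skip k x)" for l
    proof (cases "l = k")
      case False
      have "min x y \<in> {1..m - 1}" "max x y \<in> {1..m - 1}" using x y by auto
      then have "skip k (min x y) \<in> {1..m}" "skip k (max x y) \<in> {1..m}" using mem by blast+
      then have "l \<in> {1..m}" using l by simp
      then obtain l' where l': "l = skip k l'" using False im by blast
      then show ?thesis using l edge by (simp add: skip_less_iff)
    next
      case True
      \<comment> \<open>\<open>skip k\<close> fixes arguments below \<open>k\<close> but sends
        \<open>k\<close> to \<open>k + 1\<close>, hence one strict and one weak bound. So
        \<open>k - 1\<close> is either the left endpoint or strictly between the endpoints.\<close>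
      have p: "min x y < k" "k \<le> max x y"
        using l True by (auto simp: skip_def split: if_splits)
      have "i (skip k x) = i (k - 1) \<or> (i (k - 1), i (skip k x)) \<in> E"
      proof (cases "min x y = k - 1")
        case True
        then have "skip k (min x y) = k - 1" using k by (auto simp: skip_def)
        then show ?thesis using eq by (auto simp: min_def split: if_splits)
      next
        case False
        then have "min x y < k - 1" "k - 1 < max x y" "skip k (k - 1) = k - 1"
          using p k by (auto simp: skip_def)
        then show ?thesis using edge by metis
      qed
      then show ?thesis unfolding True by (rule pass[OF mem[OF x]])
    qed
    then show ?thesis
      using eq mem[OF x] mem[OF y] by (simp add: kerG_rel_def min_max_skip)
  qed
  show ?L if R: ?R
  proof -
    have eq: "i (skip k x) = i (skip k y)" using R by (simp add: kerG_rel_def)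
    have "\<forall>l. skip k (min x y) < l \<and> l < skip k (max x y) \<and> i l \<noteq> i (skip k x) \<longrightarrow>
        (i l, i (skip k x)) \<in> E"
      using R unfolding kerG_rel_def mem_Collect_eq prod.case min_max_skip
      by (elim conjE) assumption
    then have "(i (skip k l), i (skip k x)) \<in> E"
      if "min x y < l" "l < max x y" "i (skip k l) \<noteq> i (skip k x)" for l
      using that skip_less_iff by blast
    then show ?thesis using eq x y by (simp add: kerG_rel_def)
  qed
qed

text \<open>By \<open>single\<close>, no class of another position contains \<open>k\<close>, so
  each such class lies in the range of \<open>skip k\<close> and is the image of a class of the
  shortened word. The second claim allows the factor of \<open>{k}\<close> to be split off a product
  over the set of blocks.\<close>

lemma kerG_remove_singleton:
  assumes k: "k \<in> {2..m - 1}"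
    and single: "\<And>y. (k, y) \<in> kerG_rel E i m \<Longrightarrow> y = k"
    and pass: "\<And>p. p \<in> {1..m} \<Longrightarrow> i p = i (k - 1) \<or> (i (k - 1), i p) \<in> E \<Longrightarrow> (i k, i p) \<in> E"
  shows "kerG E i m = insert {k} ((`) (skip k) ` kerG E (i \<circ> skip k) (m - 1))"
    and "{k} \<notin> (`) (skip k) ` kerG E (i \<circ> skip k) (m - 1)"
proof -
  let ?R = "kerG_rel E i m" and ?R' = "kerG_rel E (i \<circ> skip k) (m - 1)"
  have km: "k \<in> {1..m}" using k by auto
  have sub: "?R \<subseteq> {1..m} \<times> {1..m}" "?R' \<subseteq> {1..m - 1} \<times> {1..m - 1}"
    by (auto simp: kerG_rel_def)
  have rel: "(x, y) \<in> ?R' \<longleftrightarrow> (skip k x, skip k y) \<in> ?R"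
    if "x \<in> {1..m - 1}" "y \<in> {1..m - 1}" for x y
    by (rule kerG_rel_skip[OF k that]) (fact pass)
  have cl: "skip k ` (?R' `` {x}) = ?R `` {skip k x}" if x: "x \<in> {1..m - 1}" for x
  proof
    show "skip k ` (?R' `` {x}) \<subseteq> ?R `` {skip k x}"
    proof (rule image_subsetI)
      fix w assume "w \<in> ?R' `` {x}"
      then have w: "(x, w) \<in> ?R'" by simp
      then have "w \<in> {1..m - 1}" using sub by blast
      then show "skip k w \<in> ?R `` {skip k x}" using rel[OF x] w by simp
    qed
    show "?R `` {skip k x} \<subseteq> skip k ` (?R' `` {x})"
    proof
      fix z assume "z \<in> ?R `` {skip k x}"
      then have z: "(skip k x, z) \<in> ?R" by simp
      have "skip k x \<noteq> k" by (simp add: skip_def)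
      then have "z \<noteq> k" using single[of "skip k x"] kerG_rel_sym[OF z] by blast
      moreover have "z \<in> {1..m}" using z sub by blast
      ultimately have "z \<in> skip k ` {1..m - 1}" unfolding skip_image[OF km] by blast
      then obtain w where w: "w \<in> {1..m - 1}" "z = skip k w" by blast
      then show "z \<in> skip k ` (?R' `` {x})" using z rel[OF x w(1)] by auto
    qed
  qed
  have "(`) (skip k) ` kerG E (i \<circ> skip k) (m - 1) = (\<lambda>x. ?R `` {skip k x}) ` {1..m - 1}"
    unfolding kerG_def quotient_def using cl by (auto simp del: atLeastAtMost_iff)
  also have "\<dots> = (\<lambda>x. ?R `` {x}) ` ({1..m} - {k})"
    unfolding skip_image[OF km, symmetric] by (simp add: image_image)
  finally have im: "(`) (skip k) ` kerG E (i \<circ> skip k) (m - 1)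
    = (\<lambda>x. ?R `` {x}) ` ({1..m} - {k})" .
  have refl: "(x, x) \<in> ?R" if "x \<in> {1..m}" for x
    using that by (auto simp: kerG_rel_def)
  have kcl: "?R `` {k} = {k}" using single refl[OF km] by auto
  have "kerG E i m = (\<lambda>x. ?R `` {x}) ` insert k ({1..m} - {k})"
    unfolding insert_Diff[OF km] by (auto simp: kerG_def quotient_def)
  then show "kerG E i m = insert {k} ((`) (skip k) ` kerG E (i \<circ> skip k) (m - 1))"
    unfolding im image_insert kcl .
  show "{k} \<notin> (`) (skip k) ` kerG E (i \<circ> skip k) (m - 1)"
    unfolding im using refl by auto
qed

lemma finite_kerG: "finite (kerG E i m)"
  unfolding kerG_def by (rule finite_quotient) (auto simp: kerG_rel_def)

lemma finite_kerG_block: "B \<in> kerG E i m \<Longrightarrow> finite B"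
  by (auto simp: kerG_def quotient_def kerG_rel_def)

text \<open>BMT independence is applied twice: to the full word, to isolate the factor of
  \<open>{k}\<close>, and to the word without \<open>k\<close>, to reassemble the remaining factors
  into one moment.\<close>

lemma BMT_factor_singleton:
  assumes bmt: "BMT_independent \<phi> I E \<A>" and word: "is_word I \<A> m i a"
    and k: "k \<in> {2..m - 1}"
    and single: "\<And>y. (k, y) \<in> kerG_rel E i m \<Longrightarrow> y = k"
    and pass: "\<And>p. p \<in> {1..m} \<Longrightarrow> i p = i (k - 1) \<or> (i (k - 1), i p) \<in> E \<Longrightarrow> (i k, i p) \<in> E"
  shows "\<phi> (restr_prod a {1..m}) = \<phi> (a k) * \<phi> (restr_prod a ({1..m} - {k}))"
proof -
  let ?K = "kerG E (i \<circ> skip k) (m - 1)"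
  have im: "skip k ` {1..m - 1} = {1..m} - {k}"
    using k by (intro skip_image) auto
  \<comment> \<open>The range of \<open>k\<close> forces \<open>m \<ge> 3\<close>, so the shortened
    word is nonempty.\<close>
  have word': "is_word I \<A> (m - 1) (i \<circ> skip k) (a \<circ> skip k)"
  proof -
    have "skip k j \<in> {1..m}" if "j \<in> {1..m - 1}" for j using im that by blast
    then show ?thesis using word k by (auto simp: is_word_def)
  qed
  have "\<phi> (restr_prod a {1..m}) = (\<Prod>B\<in>kerG E i m. \<phi> (restr_prod a B))"
    using bmt word by (auto simp: BMT_independent_def)
  also have "\<dots> = (\<Prod>B\<in>insert {k} ((`) (skip k) ` ?K). \<phi> (restr_prod a B))"
    by (subst kerG_remove_singleton(1)[OF k]) (fact single, fact pass, rule refl)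
  also have "\<dots> = \<phi> (a k) * (\<Prod>B\<in>(`) (skip k) ` ?K. \<phi> (restr_prod a B))"
  proof (subst prod.insert)
    show "{k} \<notin> (`) (skip k) ` ?K"
      by (rule kerG_remove_singleton(2)[OF k]) (fact single, fact pass)
  qed (simp_all add: finite_kerG)
  also have "(\<Prod>B\<in>(`) (skip k) ` ?K. \<phi> (restr_prod a B))
      = (\<Prod>B\<in>?K. \<phi> (restr_prod a (skip k ` B)))"
    by (subst prod.reindex) (auto intro!: inj_onI dest: inj_image_eq_iff[OF inj_skip, THEN iffD1])
  also have "\<dots> = (\<Prod>B\<in>?K. \<phi> (restr_prod (a \<circ> skip k) B))"
    by (intro prod.cong refl) (simp add: restr_prod_image finite_kerG_block strict_mono_skip)
  also have "\<dots> = \<phi> (restr_prod (a \<circ> skip k) {1..m - 1})"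
    using bmt word' by (auto simp: BMT_independent_def)
  also have "\<dots> = \<phi> (restr_prod a ({1..m} - {k}))"
    unfolding im[symmetric] by (simp add: restr_prod_image strict_mono_skip)
  finally show ?thesis .
qed

section \<open>Complete and empty graphs\<close>

lemma BMT_complete_imp_tensor:
  assumes "BMT_independent \<phi> I E \<A>" "\<forall>i\<in>I. \<forall>j\<in>I. i \<noteq> j \<longrightarrow> (i, j) \<in> E"
  shows "tensor_independent \<phi> I \<A>"
  unfolding tensor_independent_def
proof (intro allI impI)
  fix m i a assume w: "is_word I \<A> m i a"
  have "kerG E i m = ker i m"
    using w assms(2) by (intro kerG_eq_ker) (auto simp: is_word_def)
  then show "\<phi> (restr_prod a {1..m}) = (\<Prod>B\<in>ker i m. \<phi> (restr_prod a B))"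
    using assms(1) w by (auto simp: BMT_independent_def)
qed

lemma BMT_empty_imp_boolean:
  assumes "BMT_independent \<phi> I {} \<A>"
  shows "boolean_independent \<phi> I \<A>"
  unfolding boolean_independent_def
proof (intro allI impI, elim conjE)
  fix m i a assume w: "is_word I \<A> m i a" and alt: "alternating m i"
  have "\<not> x < y" if xy: "(x, y) \<in> kerG_rel {} i m" for x y
  proof
    assume "x < y"
    moreover have eq: "i x = i y" "x \<in> {1..m}" "y \<in> {1..m}"
      using xy by (auto simp: kerG_rel_def)
    \<comment> \<open>The separating position is \<open>x + 1\<close>: its colour differs from that
      of \<open>x\<close> and \<open>y\<close>, so it lies strictly between them, and there is no
      edge to let it pass.\<close>
    ultimately have "x \<in> {1..<m}" by simp
    then have ne: "i (x + 1) \<noteq> i x" using alt unfolding alternating_def by metis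
    then have "x + 1 \<noteq> y" using eq by auto
    then show False using kerG_rel_edge[OF xy, of "x + 1"] \<open>x < y\<close> ne by auto
  qed
  then show "\<phi> (restr_prod a {1..m}) = (\<Prod>k=1..m. \<phi> (a k))"
    using assms w prod_kerG_singletons[of "{}" i m \<phi> a] by (auto simp: BMT_independent_def)
qed

section \<open>The digraph of a linear order\<close>

lemma BMT_order_imp_monotone:
  assumes bmt: "BMT_independent \<phi> I E \<A>"
    and lin: "strict_linear_order_on I r"
    and E: "\<forall>i\<in>I. \<forall>j\<in>I. (i, j) \<in> E \<longleftrightarrow> (j, i) \<in> r"
  shows "monotone_independent \<phi> I r \<A>"
proof -
  have trans: "trans r" and irrefl: "irrefl r"
    using lin by (auto simp: strict_linear_order_on_def)
  have asym: "(u, v) \<in> r \<Longrightarrow> (v, u) \<notin> r" for u v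
    using trans irrefl by (meson transD irreflD)
  \<comment> \<open>Edges point from larger to smaller colours, so a block can only pass over larger
    letters. The clause \<open>l \<noteq> y\<close> serves the uses below, where \<open>l\<close> is
    adjacent to an endpoint and might coincide with the other one.\<close>
  have noedge: "l \<noteq> y \<and> \<not> (x < l \<and> l < y)"
    if xy: "(x, y) \<in> kerG_rel E i m" and w: "is_word I \<A> m i a" and l: "(i l, i x) \<in> r"
    for x y l m i a
  proof -
    have x: "i x = i y" "x \<in> {1..m}" "y \<in> {1..m}" using xy by (auto simp: kerG_rel_def)
    have ne: "i l \<noteq> i x" using l irrefl by (auto dest: irreflD)
    have False if "x < l" "l < y"
    proof -
      have "(i l, i x) \<in> E" using kerG_rel_edge[OF xy that ne] .
      moreover have "i l \<in> I" "i x \<in> I" using w x that by (auto simp: is_word_def)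
      ultimately show False using E asym l by blast
    qed
    then show ?thesis using ne x by auto
  qed
  show ?thesis
    unfolding monotone_independent_def
  proof (intro allI impI conjI ballI; elim conjE bexE)
    fix m i a k
    assume w: "is_word I \<A> m i a" and k: "k \<in> {2..m - 1}"
      and up: "(i (k - 1), i k) \<in> r" and down: "(i (k + 1), i k) \<in> r"
    have I: "p \<in> {1..m} \<Longrightarrow> i p \<in> I" for p using w by (auto simp: is_word_def)
    have kI: "i k \<in> I" "i (k - 1) \<in> I" using k by (auto intro!: I)
    show "\<phi> (restr_prod a {1..m}) = \<phi> (a k) * \<phi> (restr_prod a ({1..m} - {k}))"
    proof (rule BMT_factor_singleton[OF bmt w k])
      fix y assume ky: "(k, y) \<in> kerG_rel E i m"
      have "\<not> k < y" using noedge[OF ky w down] by auto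
      moreover have "\<not> y < k"
      proof
        assume "y < k"
        have "i y = i k" using ky by (simp add: kerG_rel_def)
        then have "(i (k - 1), i y) \<in> r" using up by simp
        then have "\<not> (y < k - 1 \<and> k - 1 < k)" using noedge[OF kerG_rel_sym[OF ky] w] by blast
        then have "y = k - 1" using \<open>y < k\<close> by auto
        then show False using noedge[OF ky w up] by auto
      qed
      ultimately show "y = k" by simp
    next
      fix p assume p: "p \<in> {1..m}" and pass: "i p = i (k - 1) \<or> (i (k - 1), i p) \<in> E"
      \<comment> \<open>In terms of the order, \<open>i p\<close> is at most
        \<open>i (k - 1)\<close>, which lies below the peak \<open>i k\<close>; transitivity then
        gives the edge.\<close>
      then have "i p = i (k - 1) \<or> (i p, i (k - 1)) \<in> r" using E I[OF p] kI by blast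
      then have "(i p, i k) \<in> r" using up trans by (auto dest: transD)
      then show "(i k, i p) \<in> E" using E I[OF p] kI by blast
    qed
  next
    fix m i a k
    assume w: "is_word I \<A> m i a" and k: "k \<in> {1..m}"
      and down: "\<forall>l\<in>{1..<k}. (i (l + 1), i l) \<in> r"
      and up: "\<forall>l\<in>{k..<m}. (i l, i (l + 1)) \<in> r"
    have "\<not> x < y" if xy: "(x, y) \<in> kerG_rel E i m" for x y
    proof
      assume "x < y"
      have x: "i x = i y" "x \<in> {1..m}" "y \<in> {1..m}" using xy by (auto simp: kerG_rel_def)
      show False
      \<comment> \<open>Left of the valley bottom \<open>k\<close> the letter just after
        \<open>x\<close> is smaller than that at \<open>x\<close>; otherwise the letter just before
        \<open>y\<close> is smaller than that at \<open>y\<close>. Either one separates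
        \<open>x\<close> from \<open>y\<close>.\<close>
      proof (cases "x < k")
        case True
        then have "(i (x + 1), i x) \<in> r" using x by (intro bspec[OF down]) auto
        from noedge[OF xy w this] show False using \<open>x < y\<close> by auto
      next
        case False
        then have "(i (y - 1), i (y - 1 + 1)) \<in> r" using up x \<open>x < y\<close> by (intro bspec[OF up]) auto
        then have r: "(i (y - 1), i x) \<in> r" using x \<open>x < y\<close> by simp
        \<comment> \<open>The remaining possibility is that \<open>x\<close> and \<open>y\<close>
          are adjacent; the letter at \<open>x\<close> would then be smaller than itself.\<close>
        from noedge[OF xy w r] have "y - 1 = x" using \<open>x < y\<close> by auto
        then show False using r irrefl by (auto dest: irreflD)
      qed
    qed
    then show "\<phi> (restr_prod a {1..m}) = (\<Prod>l=1..m. \<phi> (a l))"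
      using bmt w prod_kerG_singletons[of E i m \<phi> a] by (auto simp: BMT_independent_def)
  qed
qed

theorem proposition3p5:
  fixes scale :: "complex \<Rightarrow> 'a::ring_1 \<Rightarrow> 'a"
    and \<phi> :: "'a \<Rightarrow> complex"
    and I :: "'i set"
    and E :: "('i \<times> 'i) set"
    and \<A> :: "'i \<Rightarrow> 'a set"
  assumes "nc_probability_space scale \<phi>"
    and "\<And>i. i \<in> I \<Longrightarrow> subalgebra scale (\<A> i)"
    and "digraph I E"
    and "BMT_independent \<phi> I E \<A>"
  shows "((\<forall>i\<in>I. \<forall>j\<in>I. i \<noteq> j \<longrightarrow> (i, j) \<in> E) \<longrightarrow> tensor_independent \<phi> I \<A>) \<and>
    (E = {} \<longrightarrow> boolean_independent \<phi> I \<A>) \<and>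
    (\<forall>r. strict_linear_order_on I r \<and> (\<forall>i\<in>I. \<forall>j\<in>I. (i, j) \<in> E \<longleftrightarrow> (j, i) \<in> r) \<longrightarrow>
       monotone_independent \<phi> I r \<A>)"
proof (intro conjI impI allI; (elim conjE)?)
  show "tensor_independent \<phi> I \<A>" if "\<forall>i\<in>I. \<forall>j\<in>I. i \<noteq> j \<longrightarrow> (i, j) \<in> E"
    by (rule BMT_complete_imp_tensor[OF assms(4) that])
  show "boolean_independent \<phi> I \<A>" if "E = {}"
    by (rule BMT_empty_imp_boolean[OF assms(4)[unfolded that]])
  show "monotone_independent \<phi> I r \<A>"
    if "strict_linear_order_on I r" "\<forall>i\<in>I. \<forall>j\<in>I. (i, j) \<in> E \<longleftrightarrow> (j, i) \<in> r" for r
    by (rule BMT_order_imp_monotone[OF assms(4) that])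
qed

end
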